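(* Let $X$ and $Y$ be two Köthe function spaces with the Fatou property, both defined on the same (non-atomic) $\sigma$-finite measure space $(\Omega,\Sigma,\mu)$. Suppose that either the space $X$ is separable or the space $Y$ is reflexive. Then for every $\lambda\in M(X,Y)$ $$\|M_\lambda\colon X\to Y\|_{ess}=\|\lambda\|_{M(X,Y)}=\|M_\lambda\colon X\to Y\|.$$ In particular, there are no non-trivial (that is, non-zero) compact multiplication operators acting from $X$ into $Y$.
   Context: Let $(\Omega,\Sigma,\mu)$ be a complete $\sigma$-finite measure space and let $L_0(\Omega)$ be the space of equivalence classes (modulo equality a.e.) of real or complex valued measurable functions that are integrable over every set of finite measure. A Köthe space on $\Omega$ is a Banach space $X$ which is a linear subspace of $L_0(\Omega)$, such that if $|f|\le|g|$ a.e. with $f$ measurable and $g\in X$, then $f\in X$ and $\|f\|_X\le\|g\|_X$, and such that $\chi_A\in X$ for every $A\in\Sigma$ with $\mu(A)<\infty$. It is called a Köthe function space if the measure space is non-atomic. $X$ has the Fatou property if its closed unit ball is closed in $L_0(\Omega)$ for the topology of local convergence in measure. In the paper, separability of a Köthe space is used interchangeably with order continuity. For Köthe spaces $X,Y$ on the same measure space, $M(X,Y)=\{g\in L_0(\Omega): fg\in Y\text{ for all }f\in X\}$ with norm $\|g\|_{M(X,Y)}=\sup_{\|f\|_X\le1}\|fg\|_Y$. For $\lambda\in M(X,Y)$, the multiplication operator is $M_\lambda f=\lambda f$. The essential norm is $\|T\colon X\to Y\|_{ess}=\inf\{\|T-K\|_{X\to Y}: K\colon X\to Y\text{ compact linear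 operator}\}$. *)

theory Defs
  imports "HOL-Analysis.Analysis"
begin

text \<open>
  The scalar type \<open>'k\<close> ranges over the sort \<open>{real_normed_field, euclidean_space}\<close>, which has the
  instances \<^typ>\<open>real\<close> and \<^typ>\<open>complex\<close>, and no others up to isomorphism.

  An equivalence class modulo equality a.e. is represented by its members: a space of classes is a
  set of functions that contains with a function all its measurable modifications on null sets, its
  norm is a function of representatives, and equality of classes is equality a.e.  For Koethe spaces
  saturation and well-definedness of the norm are consequences of the ideal property.
\<close>

definition L0 :: "'a measure \<Rightarrow> ('a \<Rightarrow> 'k::{real_normed_field, euclidean_space}) set" where
  "L0 M = {f \<in> borel_measurable M. \<forall>A\<in>sets M. emeasure M A < \<infinity> \<longrightarrow> set_integrable M A f}"

definition atom_of :: "'a measure \<Rightarrow> 'a set \<Rightarrow> bool" where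
  "atom_of M A \<longleftrightarrow> A \<in> sets M \<and> emeasure M A > 0 \<and>
    (\<forall>B\<in>sets M. B \<subseteq> A \<longrightarrow> emeasure M B = 0 \<or> emeasure M (A - B) = 0)"

definition non_atomic :: "'a measure \<Rightarrow> bool" where
  "non_atomic M \<longleftrightarrow> (\<nexists>A. atom_of M A)"

locale koethe_space = complete_measure M + sigma_finite_measure M
  for M :: "'a measure" +
  fixes X :: "('a \<Rightarrow> 'k::{real_normed_field, euclidean_space}) set"
    and nrm :: "('a \<Rightarrow> 'k) \<Rightarrow> real"
  assumes subset_L0: "X \<subseteq> L0 M"
    and zero_mem: "(\<lambda>x. 0) \<in> X"
    and add_mem: "\<And>f g. f \<in> X \<Longrightarrow> g \<in> X \<Longrightarrow> (\<lambda>x. f x + g x) \<in> X"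
    and scale_mem: "\<And>c f. f \<in> X \<Longrightarrow> (\<lambda>x. c * f x) \<in> X"
    and nrm_nonneg: "\<And>f. f \<in> X \<Longrightarrow> 0 \<le> nrm f"
    and nrm_eq_0_iff: "\<And>f. f \<in> X \<Longrightarrow> nrm f = 0 \<longleftrightarrow> (AE x in M. f x = 0)"
    and nrm_scale: "\<And>c f. f \<in> X \<Longrightarrow> nrm (\<lambda>x. c * f x) = norm c * nrm f"
    and nrm_triangle: "\<And>f g. f \<in> X \<Longrightarrow> g \<in> X \<Longrightarrow> nrm (\<lambda>x. f x + g x) \<le> nrm f + nrm g"
    and nrm_complete: "\<And>F :: nat \<Rightarrow> 'a \<Rightarrow> 'k. (\<And>n. F n \<in> X) \<Longrightarrow>
      (\<And>e. e > 0 \<Longrightarrow> \<exists>n0. \<forall>m\<ge>n0. \<forall>n\<ge>n0. nrm (\<lambda>x. F m x - F n x) < e) \<Longrightarrow>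
      \<exists>f\<in>X. (\<lambda>n. nrm (\<lambda>x. F n x - f x)) \<longlonglongrightarrow> 0"
    and ideal: "\<And>f g. g \<in> X \<Longrightarrow> f \<in> borel_measurable M \<Longrightarrow>
      (AE x in M. norm (f x) \<le> norm (g x)) \<Longrightarrow> f \<in> X \<and> nrm f \<le> nrm g"
    and indicator_mem: "\<And>A. A \<in> sets M \<Longrightarrow> emeasure M A < \<infinity> \<Longrightarrow> indicator A \<in> X"

locale koethe_function_space = koethe_space +
  assumes non_atomic: "non_atomic M"

definition local_measure_open ::
  "'a measure \<Rightarrow> ('a \<Rightarrow> 'k::{real_normed_field, euclidean_space}) set \<Rightarrow> bool" where
  "local_measure_open M U \<longleftrightarrow> U \<subseteq> L0 M \<and>
    (\<forall>f\<in>U. \<exists>A\<in>sets M. emeasure M A < \<infinity> \<and>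
      (\<exists>e>0. {g \<in> L0 M. measure M {x \<in> A. norm (g x - f x) \<ge> e} < e} \<subseteq> U))"

definition local_measure_topology ::
  "'a measure \<Rightarrow> ('a \<Rightarrow> 'k::{real_normed_field, euclidean_space}) topology" where
  "local_measure_topology M = topology (local_measure_open M)"

lemma local_measure_nbhd_mono:
  fixes f g :: "'a \<Rightarrow> 'k::{real_normed_field, euclidean_space}"
  assumes "f \<in> L0 M" "g \<in> L0 M" "A \<subseteq> B" "A \<in> sets M" "B \<in> sets M" "emeasure M B < \<infinity>"
    and "d \<le> e" and small: "measure M {x \<in> B. norm (g x - f x) \<ge> d} < d"
  shows "measure M {x \<in> A. norm (g x - f x) \<ge> e} < e"
proof -
  have [measurable]: "f \<in> borel_measurable M" "g \<in> borel_measurable M" "A \<in> sets M" "B \<in> sets M"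
    using assms by (auto simp: L0_def)
  have *: "{x \<in> C. norm (g x - f x) \<ge> c} \<in> sets M" if [measurable]: "C \<in> sets M" for C c
  proof -
    have eq: "{x \<in> C. norm (g x - f x) \<ge> c} = C \<inter> {x \<in> space M. norm (g x - f x) \<ge> c}"
      using sets.sets_into_space[OF that] by auto
    show ?thesis unfolding eq by measurable
  qed
  have "B \<in> fmeasurable M"
    using \<open>B \<in> sets M\<close> \<open>emeasure M B < \<infinity>\<close> by (simp add: fmeasurable_def)
  moreover have "{x \<in> B. norm (g x - f x) \<ge> d} \<subseteq> B"
    by (rule Collect_restrict)
  moreover have "{x \<in> B. norm (g x - f x) \<ge> d} \<in> sets M"
    using \<open>B \<in> sets M\<close> by (rule *)
  ultimately have fin: "{x \<in> B. norm (g x - f x) \<ge> d} \<in> fmeasurable M"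
    by (rule fmeasurableI2)
  have sub: "{x \<in> A. norm (g x - f x) \<ge> e} \<subseteq> {x \<in> B. norm (g x - f x) \<ge> d}"
  proof
    fix x assume "x \<in> {x \<in> A. norm (g x - f x) \<ge> e}"
    with \<open>A \<subseteq> B\<close> \<open>d \<le> e\<close> show "x \<in> {x \<in> B. norm (g x - f x) \<ge> d}"
      by (simp add: subset_iff)
  qed
  have "{x \<in> A. norm (g x - f x) \<ge> e} \<in> sets M"
    using \<open>A \<in> sets M\<close> by (rule *)
  with sub have "measure M {x \<in> A. norm (g x - f x) \<ge> e} \<le> measure M {x \<in> B. norm (g x - f x) \<ge> d}"
    using fin by (rule measure_mono_fmeasurable)
  then show ?thesis using \<open>d \<le> e\<close> small by linarith
qed

lemma istopology_local_measure_open: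
  "istopology (local_measure_open M :: ('a \<Rightarrow> 'k::{real_normed_field, euclidean_space}) set \<Rightarrow> bool)"
  unfolding istopology_def
proof (intro conjI allI impI)
  fix S T :: "('a \<Rightarrow> 'k) set"
  assume S: "local_measure_open M S" and T: "local_measure_open M T"
  show "local_measure_open M (S \<inter> T)"
    unfolding local_measure_open_def
  proof (intro conjI ballI)
    show "S \<inter> T \<subseteq> L0 M" using S by (auto simp: local_measure_open_def)
    fix f assume f: "f \<in> S \<inter> T"
    then have fL: "f \<in> L0 M" using S by (auto simp: local_measure_open_def)
    obtain A d where A: "A \<in> sets M" "emeasure M A < \<infinity>" "d > 0"
      "{g \<in> L0 M. measure M {x \<in> A. norm (g x - f x) \<ge> d} < d} \<subseteq> S"
      using S f unfolding local_measure_open_def by blast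
    obtain B e where B: "B \<in> sets M" "emeasure M B < \<infinity>" "e > 0"
      "{g \<in> L0 M. measure M {x \<in> B. norm (g x - f x) \<ge> e} < e} \<subseteq> T"
      using T f unfolding local_measure_open_def by blast
    have fin: "emeasure M (A \<union> B) < \<infinity>"
      using emeasure_subadditive[OF A(1) B(1)] A(2) B(2)
      by (metis ennreal_add_less_top infinity_ennreal_def le_less_trans)
    have "{g \<in> L0 M. measure M {x \<in> A \<union> B. norm (g x - f x) \<ge> min d e} < min d e} \<subseteq> S \<inter> T"
    proof
      fix g assume g: "g \<in> {g \<in> L0 M. measure M {x \<in> A \<union> B. norm (g x - f x) \<ge> min d e} < min d e}"
      then have gL: "g \<in> L0 M"
        and small: "measure M {x \<in> A \<union> B. norm (g x - f x) \<ge> min d e} < min d e"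
        by simp_all
      have AB: "A \<union> B \<in> sets M" using A(1) B(1) by (rule sets.Un)
      have "measure M {x \<in> A. norm (g x - f x) \<ge> d} < d"
        by (rule local_measure_nbhd_mono[OF fL gL Un_upper1 A(1) AB fin min.cobounded1 small])
      with gL A(4) have "g \<in> S" by (simp add: subset_iff)
      have "measure M {x \<in> B. norm (g x - f x) \<ge> e} < e"
        by (rule local_measure_nbhd_mono[OF fL gL Un_upper2 B(1) AB fin min.cobounded2 small])
      with gL B(4) have "g \<in> T" by (simp add: subset_iff)
      with \<open>g \<in> S\<close> show "g \<in> S \<inter> T" by simp
    qed
    then show "\<exists>A\<in>sets M. emeasure M A < \<infinity> \<and>
        (\<exists>e>0. {g \<in> L0 M. measure M {x \<in> A. norm (g x - f x) \<ge> e} < e} \<subseteq> S \<inter> T)"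
      using fin A(1,3) B(1,3) by (intro bexI[of _ "A \<union> B"] conjI exI[of _ "min d e"]) simp_all
  qed
next
  fix \<K> :: "('a \<Rightarrow> 'k) set set"
  assume K: "\<forall>S\<in>\<K>. local_measure_open M S"
  show "local_measure_open M (\<Union>\<K>)"
    unfolding local_measure_open_def
  proof (intro conjI ballI)
    show "\<Union>\<K> \<subseteq> L0 M" using K by (auto simp: local_measure_open_def)
    fix f assume "f \<in> \<Union>\<K>"
    then obtain S where S: "S \<in> \<K>" "f \<in> S" by blast
    then obtain A e where "A \<in> sets M" "emeasure M A < \<infinity>" "e > 0"
      "{g \<in> L0 M. measure M {x \<in> A. norm (g x - f x) \<ge> e} < e} \<subseteq> S"
      using K unfolding local_measure_open_def by blast
    moreover from S(1) have "S \<subseteq> \<Union>\<K>" by blast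
    ultimately show "\<exists>A\<in>sets M. emeasure M A < \<infinity> \<and>
        (\<exists>e>0. {g \<in> L0 M. measure M {x \<in> A. norm (g x - f x) \<ge> e} < e} \<subseteq> \<Union>\<K>)"
      by (meson order_trans)
  qed
qed

lemma openin_local_measure_topology:
  "openin (local_measure_topology M) = local_measure_open M"
  unfolding local_measure_topology_def
  by (rule topology_inverse'[OF istopology_local_measure_open])

definition fatou_property ::
  "'a measure \<Rightarrow> ('a \<Rightarrow> 'k::{real_normed_field, euclidean_space}) set \<Rightarrow> (('a \<Rightarrow> 'k) \<Rightarrow> real) \<Rightarrow> bool" where
  "fatou_property M X nX \<longleftrightarrow> closedin (local_measure_topology M) {f \<in> X. nX f \<le> 1}"

definition norm_separable :: "('a \<Rightarrow> 'k::real_normed_field) set \<Rightarrow> (('a \<Rightarrow> 'k) \<Rightarrow> real) \<Rightarrow> bool" where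
  "norm_separable X nX \<longleftrightarrow>
    (\<exists>D\<subseteq>X. countable D \<and> (\<forall>f\<in>X. \<forall>e>0. \<exists>d\<in>D. nX (\<lambda>x. f x - d x) < e))"

text \<open>
  A dual space is again a space of \<open>'k\<close>-valued functions with the pointwise operations, so the
  bidual is obtained by iterating the construction.  Functionals that agree on \<open>X\<close> represent
  the same element of the dual; their difference has dual norm 0, so elements of the bidual
  do not distinguish them.
\<close>

definition dual_space ::
  "('b \<Rightarrow> 'k::real_normed_field) set \<Rightarrow> (('b \<Rightarrow> 'k) \<Rightarrow> real) \<Rightarrow> (('b \<Rightarrow> 'k) \<Rightarrow> 'k) set" where
  "dual_space X nX = {\<phi>.
    (\<forall>f\<in>X. \<forall>g\<in>X. \<phi> (\<lambda>x. f x + g x) = \<phi> f + \<phi> g) \<and>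
    (\<forall>c. \<forall>f\<in>X. \<phi> (\<lambda>x. c * f x) = c * \<phi> f) \<and>
    (\<exists>C. \<forall>f\<in>X. norm (\<phi> f) \<le> C * nX f)}"

definition dual_norm ::
  "('b \<Rightarrow> 'k::real_normed_field) set \<Rightarrow> (('b \<Rightarrow> 'k) \<Rightarrow> real) \<Rightarrow> (('b \<Rightarrow> 'k) \<Rightarrow> 'k) \<Rightarrow> real" where
  "dual_norm X nX \<phi> = (SUP f\<in>{f \<in> X. nX f \<le> 1}. norm (\<phi> f))"

definition reflexive_space ::
  "('b \<Rightarrow> 'k::real_normed_field) set \<Rightarrow> (('b \<Rightarrow> 'k) \<Rightarrow> real) \<Rightarrow> bool" where
  "reflexive_space X nX \<longleftrightarrow>
    (\<forall>\<Phi>\<in>dual_space (dual_space X nX) (dual_norm X nX). \<exists>f\<in>X. \<forall>\<phi>\<in>dual_space X nX. \<Phi> \<phi> = \<phi> f)"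

text \<open>
  Operators act on representatives and are linear modulo equality a.e.; every linear operator
  between the spaces of classes has such a representation.
\<close>

definition linear_operator ::
  "'a measure \<Rightarrow> ('a \<Rightarrow> 'k::real_normed_field) set \<Rightarrow> ('a \<Rightarrow> 'k) set \<Rightarrow>
    (('a \<Rightarrow> 'k) \<Rightarrow> ('a \<Rightarrow> 'k)) \<Rightarrow> bool" where
  "linear_operator M X Y T \<longleftrightarrow>
    (\<forall>f\<in>X. T f \<in> Y) \<and>
    (\<forall>f\<in>X. \<forall>g\<in>X. (AE x in M. f x = g x) \<longrightarrow> (AE x in M. T f x = T g x)) \<and>
    (\<forall>f\<in>X. \<forall>g\<in>X. AE x in M. T (\<lambda>x. f x + g x) x = T f x + T g x) \<and>
    (\<forall>c. \<forall>f\<in>X. AE x in M. T (\<lambda>x. c * f x) x = c * T f x)"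

definition compact_operator ::
  "'a measure \<Rightarrow> ('a \<Rightarrow> 'k::real_normed_field) set \<Rightarrow> (('a \<Rightarrow> 'k) \<Rightarrow> real) \<Rightarrow>
    ('a \<Rightarrow> 'k) set \<Rightarrow> (('a \<Rightarrow> 'k) \<Rightarrow> real) \<Rightarrow> (('a \<Rightarrow> 'k) \<Rightarrow> ('a \<Rightarrow> 'k)) \<Rightarrow> bool" where
  "compact_operator M X nX Y nY K \<longleftrightarrow> linear_operator M X Y K \<and>
    (\<forall>F :: nat \<Rightarrow> 'a \<Rightarrow> 'k. (\<forall>n. F n \<in> X \<and> nX (F n) \<le> 1) \<longrightarrow>
      (\<exists>r. strict_mono r \<and> (\<exists>y\<in>Y. (\<lambda>n. nY (\<lambda>x. K (F (r n)) x - y x)) \<longlonglongrightarrow> 0)))"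

text \<open>
  The suprema are real-valued; in the uses below they are taken over bounded sets, since
  compact operators and multiplication operators between Koethe spaces are bounded.
\<close>

definition operator_norm ::
  "('a \<Rightarrow> 'k::real_normed_field) set \<Rightarrow> (('a \<Rightarrow> 'k) \<Rightarrow> real) \<Rightarrow> (('a \<Rightarrow> 'k) \<Rightarrow> real) \<Rightarrow>
    (('a \<Rightarrow> 'k) \<Rightarrow> ('a \<Rightarrow> 'k)) \<Rightarrow> real" where
  "operator_norm X nX nY T = (SUP f\<in>{f \<in> X. nX f \<le> 1}. nY (T f))"

definition essential_norm ::
  "'a measure \<Rightarrow> ('a \<Rightarrow> 'k::real_normed_field) set \<Rightarrow> (('a \<Rightarrow> 'k) \<Rightarrow> real) \<Rightarrow>
    ('a \<Rightarrow> 'k) set \<Rightarrow> (('a \<Rightarrow> 'k) \<Rightarrow> real) \<Rightarrow> (('a \<Rightarrow> 'k) \<Rightarrow> ('a \<Rightarrow> 'k)) \<Rightarrow> real" where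
  "essential_norm M X nX Y nY T =
    (INF K\<in>{K. compact_operator M X nX Y nY K}. operator_norm X nX nY (\<lambda>f x. T f x - K f x))"

definition multipliers :: "'a measure \<Rightarrow> ('a \<Rightarrow> 'k::{real_normed_field, euclidean_space}) set \<Rightarrow>
    ('a \<Rightarrow> 'k) set \<Rightarrow> ('a \<Rightarrow> 'k) set" where
  "multipliers M X Y = {g \<in> L0 M. \<forall>f\<in>X. (\<lambda>x. f x * g x) \<in> Y}"

definition multiplier_norm ::
  "('a \<Rightarrow> 'k::real_normed_field) set \<Rightarrow> (('a \<Rightarrow> 'k) \<Rightarrow> real) \<Rightarrow> (('a \<Rightarrow> 'k) \<Rightarrow> real) \<Rightarrow>
    ('a \<Rightarrow> 'k) \<Rightarrow> real" where
  "multiplier_norm X nX nY g = (SUP f\<in>{f \<in> X. nX f \<le> 1}. nY (\<lambda>x. f x * g x))"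

definition mult_op :: "('a \<Rightarrow> 'k::real_normed_field) \<Rightarrow> ('a \<Rightarrow> 'k) \<Rightarrow> ('a \<Rightarrow> 'k)" where
  "mult_op l f = (\<lambda>x. l x * f x)"

end

theory Submission
  imports Defs
begin

text \<open>
  Write \<open>c = \<parallel>M\<^sub>l - K\<parallel>\<close> for a compact \<open>K\<close>, take \<open>f\<close> in the unit ball of \<open>X\<close> and put
  \<open>g = l f\<close>.  Everything rests on the inequality \<open>\<parallel>g\<parallel> \<le> c\<close>: a supremum over \<open>f\<close> gives
  \<open>\<parallel>M\<^sub>l\<parallel> \<le> \<parallel>M\<^sub>l - K\<parallel>\<close>, hence the value of the essential norm (the choice \<open>K = 0\<close> attains it), and
  the choice \<open>K = M\<^sub>l\<close> shows that a compact \<open>M\<^sub>l\<close> vanishes.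

  The inequality comes from averaging out random signs.  Since the measure is non-atomic, every set
  \<open>A\<close> of finite measure carries a Rademacher-like sequence \<open>r\<^sub>n\<close> with values \<open>1\<close> and \<open>-1\<close> that is
  orthogonal in \<open>L\<^sub>2(A)\<close>.  The functions \<open>r\<^sub>n f\<close> stay in the unit ball, so along a subsequence
  \<open>K (r\<^sub>n f)\<close> converges to some \<open>y\<close> in \<open>Y\<close>, and \<open>r\<^sub>n g - y\<close> differs from
  \<open>(M\<^sub>l - K) (r\<^sub>n f)\<close> by a norm-null sequence; from some index on its norm is at most \<open>c + e\<close>.
  Multiplication by \<open>r\<^sub>n\<close> preserves the norm, and \<open>r\<^sub>n\<^sup>2 = 1\<close>, so \<open>g - r\<^sub>n y\<close> obeys the same bound, and
  so does every average \<open>g - a y\<close>, where \<open>a\<close> is the mean of \<open>r\<^sub>n\<close> over finitely many members of the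
  subsequence.  By orthogonality these means tend to \<open>0\<close> in \<open>L\<^sub>2(A)\<close>, so \<open>g - a y\<close> comes close
  to \<open>g\<close> in measure on \<open>A\<close>, and as the balls of \<open>Y\<close> are closed for convergence in measure on
  sets of finite measure (Fatou property), \<open>\<parallel>g\<parallel> \<le> c + e\<close>.

  The averages are treated in \<open>averages_small_in_measure\<close>, the passage to the limit in
  \<open>norm_le_of_sign_flips\<close>, the use of compactness in \<open>norm_mult_op_le_of_compact\<close>.
  The real-valued suprema make sense because multiplication operators are bounded
  (\<open>multiplier_bounded\<close>) and compact operators are bounded (\<open>compact_operator_bounded\<close>).
\<close>

section \<open>Orthogonal signs on non-atomic measure spaces\<close>

text \<open>
  Of the two parts into which a non-atom splits, one has at most half the measure; iterate.
\<close>

lemma non_atomic_small_subset: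
  assumes na: "non_atomic M" and A: "A \<in> fmeasurable M" and pos: "measure M A > 0" and "e > 0"
  shows "\<exists>B\<in>sets M. B \<subseteq> A \<and> 0 < measure M B \<and> measure M B \<le> e"
proof -
  have half: "\<exists>B\<in>fmeasurable M. B \<subseteq> C \<and> 0 < measure M B \<and> measure M B \<le> measure M C / 2"
    if C: "C \<in> fmeasurable M" "measure M C > 0" for C
  proof -
    have "\<not> atom_of M C" using na by (auto simp: non_atomic_def)
    moreover have "emeasure M C > 0"
      using C by (simp add: emeasure_eq_measure2 fmeasurableD2)
    ultimately obtain B where B: "B \<in> sets M" "B \<subseteq> C" "emeasure M B \<noteq> 0" "emeasure M (C - B) \<noteq> 0"
      using C by (auto simp: atom_of_def)
    have B': "B \<in> fmeasurable M" and D: "C - B \<in> fmeasurable M"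
      using C B by (auto intro: fmeasurableI2)
    have pos: "measure M B > 0" "measure M (C - B) > 0"
      using B B' D by (auto simp: emeasure_eq_measure2 zero_less_measure_iff)
    have "measure M (C - B) = measure M C - measure M B"
      using C B by (intro measure_Diff) (auto simp: fmeasurable_def)
    show ?thesis
    proof (cases "measure M B \<le> measure M C / 2")
      case True
      with B B' \<open>measure M B > 0\<close> show ?thesis by blast
    next
      case False
      with D \<open>measure M (C - B) > 0\<close> \<open>measure M (C - B) = _\<close> show ?thesis
        by (intro bexI[of _ "C - B"]) auto
    qed
  qed
  have iter: "\<exists>B\<in>fmeasurable M. B \<subseteq> A \<and> 0 < measure M B \<and> measure M B \<le> measure M A / 2 ^ n" for n
  proof (induction n)
    case 0
    show ?case using A pos by auto
  next
    case (Suc n)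
    then obtain B where B: "B \<in> fmeasurable M" "B \<subseteq> A" "0 < measure M B" "measure M B \<le> measure M A / 2 ^ n"
      by blast
    from half[OF B(1,3)] obtain C where "C \<in> fmeasurable M" "C \<subseteq> B" "0 < measure M C"
        "measure M C \<le> measure M B / 2" by blast
    with B show ?case by (intro bexI[of _ C]) auto
  qed
  have "\<exists>n. measure M A / e < 2 ^ n" by (rule real_arch_pow) simp
  then obtain n where "measure M A / e < 2 ^ n" ..
  then have "measure M A / 2 ^ n < e" using \<open>e > 0\<close> by (simp add: field_simps)
  with iter[of n] show ?thesis by (auto simp: fmeasurable_def intro: less_imp_le)
qed

text \<open>
  Sierpinski's theorem, by exhaustion.  Among the subsets of \<open>A\<close> of measure at most \<open>t\<close>, build an
  increasing sequence whose every step gains at least half of what can still be gained.  The gains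
  tend to \<open>0\<close>, so nothing more can be added to the union; a small subset of the complement
  could be added if the measure of the union were below \<open>t\<close>.
\<close>

lemma non_atomic_intermediate_value:
  assumes na: "non_atomic M" and A: "A \<in> fmeasurable M" and t: "0 \<le> t" "t \<le> measure M A"
  shows "\<exists>B\<in>sets M. B \<subseteq> A \<and> measure M B = t"
proof -
  define P where "P C \<longleftrightarrow> C \<in> sets M \<and> C \<subseteq> A \<and> measure M C \<le> t" for C
  define Q where "Q C C' \<longleftrightarrow> C \<subseteq> C' \<and>
     (\<forall>D. P D \<and> C \<subseteq> D \<longrightarrow> measure M D - measure M C \<le> 2 * (measure M C' - measure M C))" for C C'
  have fin: "C \<in> fmeasurable M" if "C \<in> sets M" "C \<subseteq> A" for C
    using A that by (auto intro: fmeasurableI2)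
  have step: "\<exists>C'. P C' \<and> Q C C'" if C: "P C" for C
  proof -
    define V where "V = measure M ` {D. P D \<and> C \<subseteq> D}"
    have V: "V \<noteq> {}" "bdd_above V" using C by (auto simp: V_def P_def intro!: bdd_aboveI[of _ t])
    show ?thesis
    proof (cases "Sup V = measure M C")
      case True
      then have "measure M D \<le> measure M C" if "P D" "C \<subseteq> D" for D
        using cSup_upper[OF _ V(2), of "measure M D"] that by (auto simp: V_def)
      with C show ?thesis by (auto simp: Q_def)
    next
      case False
      moreover have "measure M C \<le> Sup V" using C V by (auto intro!: cSup_upper simp: V_def)
      ultimately have "(Sup V + measure M C) / 2 < Sup V" by simp
      then obtain v where "v \<in> V" "(Sup V + measure M C) / 2 < v"
        using less_cSupD[OF V(1)] by blast
      then obtain C' where C': "P C'" "C \<subseteq> C'" "(Sup V + measure M C) / 2 < measure M C'"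
        by (auto simp: V_def)
      have "measure M D - measure M C \<le> 2 * (measure M C' - measure M C)" if "P D" "C \<subseteq> D" for D
        using cSup_upper[OF _ V(2), of "measure M D"] C' that by (auto simp: V_def field_simps)
      with C' show ?thesis by (auto simp: Q_def)
    qed
  qed
  have "P {}" using t by (auto simp: P_def)
  then obtain C where C: "\<And>n. P (C n)" "\<And>n. Q (C n) (C (Suc n))"
    using dependent_nat_choice[of "\<lambda>_. P" "\<lambda>_. Q"] step by metis
  define B where "B = (\<Union>n. C n)"
  have inc: "incseq C" using C(2) by (auto simp: Q_def incseq_Suc_iff)
  have B: "B \<in> sets M" "B \<subseteq> A" using C(1) by (auto simp: B_def P_def)
  have lim: "(\<lambda>n. measure M (C n)) \<longlonglongrightarrow> measure M B"
    unfolding B_def using C(1) inc fin[OF B]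
    by (intro Lim_measure_incseq) (auto simp: P_def B_def fmeasurable_def)
  have Bt: "measure M B \<le> t" using LIMSEQ_le_const2[OF lim] C(1) by (auto simp: P_def)
  have "measure M B = t"
  proof (rule ccontr)
    assume "measure M B \<noteq> t"
    with Bt have less: "measure M B < t" by simp
    have diff: "measure M (A - B) = measure M A - measure M B"
      using A B by (intro measure_Diff) (auto simp: fmeasurable_def)
    obtain D where D: "D \<in> sets M" "D \<subseteq> A - B" "0 < measure M D" "measure M D \<le> t - measure M B"
      using non_atomic_small_subset[OF na, of "A - B" "t - measure M B"] fmeasurable.Diff[OF A fin[OF B]]
        diff less t by auto
    have "D \<in> fmeasurable M" using D by (intro fin) auto
    then have un: "measure M (B \<union> D) = measure M B + measure M D"
      using D B fin[OF B] by (intro measure_Union) (auto simp: fmeasurable_def)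
    have "P (B \<union> D)" using D B un by (auto simp: P_def)
    have "measure M (B \<union> D) - measure M (C n) \<le> 2 * (measure M (C (Suc n)) - measure M (C n))" for n
      using C(2)[of n] \<open>P (B \<union> D)\<close> by (auto simp: Q_def B_def)
    moreover have "(\<lambda>n. measure M (B \<union> D) - measure M (C n)) \<longlonglongrightarrow> measure M (B \<union> D) - measure M B"
      by (intro tendsto_intros lim)
    moreover have "(\<lambda>n. 2 * (measure M (C (Suc n)) - measure M (C n))) \<longlonglongrightarrow> 2 * (measure M B - measure M B)"
      by (intro tendsto_intros lim LIMSEQ_Suc)
    ultimately have "measure M (B \<union> D) - measure M B \<le> 2 * (measure M B - measure M B)"
      by (intro LIMSEQ_le) auto
    with un D show False by simp
  qed
  with B show ?thesis by blast
qed

text \<open>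
  To halve one further set \<open>T\<close>, halve the sets in \<open>\<S>\<close> separately inside \<open>A \<inter> T\<close> and inside \<open>A - T\<close>;
  this is why \<open>A\<close> has to vary in the induction.
\<close>

lemma simultaneous_halving:
  assumes na: "non_atomic M" and "finite \<S>" "\<S> \<subseteq> sets M" "A \<in> fmeasurable M"
  shows "\<exists>E\<in>sets M. E \<subseteq> A \<and> measure M E = measure M A / 2 \<and>
    (\<forall>S\<in>\<S>. measure M (E \<inter> S) = measure M (A \<inter> S) / 2)"
  using assms(2-)
proof (induction \<S> arbitrary: A rule: finite_induct)
  case empty
  then show ?case using non_atomic_intermediate_value[OF na, of A "measure M A / 2"] by auto
next
  case (insert T \<S>)
  have [measurable]: "T \<in> sets M" and fm: "A \<inter> T \<in> fmeasurable M" "A - T \<in> fmeasurable M"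
    using insert.prems by (auto intro: fmeasurableI2)
  obtain E where E: "E \<in> sets M" "E \<subseteq> A \<inter> T" "measure M E = measure M (A \<inter> T) / 2"
      "\<And>S. S \<in> \<S> \<Longrightarrow> measure M (E \<inter> S) = measure M (A \<inter> T \<inter> S) / 2"
    using insert.IH[of "A \<inter> T"] insert.prems fm by auto
  obtain F where F: "F \<in> sets M" "F \<subseteq> A - T" "measure M F = measure M (A - T) / 2"
      "\<And>S. S \<in> \<S> \<Longrightarrow> measure M (F \<inter> S) = measure M ((A - T) \<inter> S) / 2"
    using insert.IH[of "A - T"] insert.prems fm by auto
  have split: "measure M (G \<union> H) = measure M G + measure M H"
    if "G \<in> sets M" "H \<in> sets M" "G \<subseteq> A \<inter> T" "H \<subseteq> A - T" for G H
    using that fmeasurableI2[OF fm(1) that(3,1)] fmeasurableI2[OF fm(2) that(4,2)]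
    by (intro measure_Union) (auto simp: fmeasurable_def)
  have A: "A \<in> sets M" using insert.prems by auto
  have "measure M (E \<union> F) = measure M A / 2"
    using split[of E F] split[of "A \<inter> T" "A - T"] E F A fm by (simp add: Int_Diff_Un)
  moreover have "measure M ((E \<union> F) \<inter> T) = measure M (A \<inter> T) / 2"
  proof -
    have "(E \<union> F) \<inter> T = E" using E F by auto
    then show ?thesis using E by simp
  qed
  moreover have "measure M ((E \<union> F) \<inter> S) = measure M (A \<inter> S) / 2" if "S \<in> \<S>" for S
  proof -
    have S: "S \<in> sets M" using that insert.prems by auto
    have eq: "(E \<union> F) \<inter> S = (E \<inter> S) \<union> (F \<inter> S)" "A \<inter> S = (A \<inter> T \<inter> S) \<union> ((A - T) \<inter> S)" by auto
    have "measure M ((E \<union> F) \<inter> S) = measure M (E \<inter> S) + measure M (F \<inter> S)"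
      unfolding eq using E F S by (intro split) auto
    moreover have "measure M (A \<inter> S) = measure M (A \<inter> T \<inter> S) + measure M ((A - T) \<inter> S)"
      unfolding eq(2) using A S by (intro split) auto
    ultimately show ?thesis using E(4) F(4) that by simp
  qed
  ultimately show ?case using E F by (intro bexI[of _ "E \<union> F"]) auto
qed

text \<open>
  The conditions say that the indicators of the sets \<open>E n\<close> are independent fair coins pairwise, with
  respect to the normalised measure on \<open>A\<close>.
\<close>

definition halving_system :: "'a measure \<Rightarrow> 'a set \<Rightarrow> (nat \<Rightarrow> 'a set) \<Rightarrow> bool" where
  "halving_system M A E \<longleftrightarrow>
    (\<forall>n. E n \<in> sets M \<and> E n \<subseteq> A \<and> measure M (E n) = measure M A / 2) \<and>
    (\<forall>m n. m \<noteq> n \<longrightarrow> measure M (E m \<inter> E n) = measure M A / 4)"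

text \<open>
  Choose \<open>E n\<close> by well-founded recursion, halving all sets chosen before.
\<close>

lemma halving_system_exists:
  assumes na: "non_atomic M" and A: "A \<in> fmeasurable M"
  shows "\<exists>E. halving_system M A E"
proof -
  define P where "P E n R \<longleftrightarrow> R \<in> sets M \<and> R \<subseteq> A \<and> measure M R = measure M A / 2 \<and>
    (\<forall>m<n. measure M (R \<inter> E m) = measure M A / 4)" for E :: "nat \<Rightarrow> 'a set" and n R
  have "\<exists>E. \<forall>n. P E n (E n)"
  proof (rule dependent_wellorder_choice)
    show "P f n R = P g n R" if "\<And>m. m < n \<Longrightarrow> f m = g m" for R f g n
      using that by (simp add: P_def)
    show "\<exists>R. P E n R" if *: "\<And>m. m < n \<Longrightarrow> P E m (E m)" for n E
    proof -
      have half: "measure M (A \<inter> E m) / 2 = measure M A / 4" if "m < n" for m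
      proof -
        have "A \<inter> E m = E m" "measure M (E m) = measure M A / 2"
          using *[OF that] by (auto simp: P_def)
        then show ?thesis by simp
      qed
      obtain R where R: "R \<in> sets M" "R \<subseteq> A" "measure M R = measure M A / 2"
          "\<forall>S\<in>E ` {..<n}. measure M (R \<inter> S) = measure M (A \<inter> S) / 2"
        using * simultaneous_halving[OF na _ _ A, of "E ` {..<n}"] by (auto simp: P_def)
      have "P E n R"
        unfolding P_def
      proof (intro conjI allI impI)
        fix m assume "m < n"
        with R(4) have "measure M (R \<inter> E m) = measure M (A \<inter> E m) / 2" by blast
        then show "measure M (R \<inter> E m) = measure M A / 4"
          using half[OF \<open>m < n\<close>] by (rule trans)
      qed (use R in auto)
      then show ?thesis ..
    qed
  qed
  then obtain E where E: "\<And>n. P E n (E n)" by blast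
  have "measure M (E m \<inter> E n) = measure M A / 4" if "m \<noteq> n" for m n
    using that E[of m] E[of n] by (cases m n rule: linorder_cases) (auto simp: P_def Int_commute)
  with E have "halving_system M A E" unfolding P_def halving_system_def by blast
  then show ?thesis by (rule exI[where x = E])
qed

text \<open>
  The Rademacher function of a member \<open>E\<close> of a halving system.  It equals \<open>1\<close> outside of \<open>A\<close>, so
  that multiplication by it is isometric on functions on the whole space.
\<close>

definition sign_flip :: "'a set \<Rightarrow> 'a \<Rightarrow> real" where
  "sign_flip E x = (if x \<in> E then - 1 else 1)"

lemma sign_flip_measurable [measurable]: "E \<in> sets M \<Longrightarrow> sign_flip E \<in> borel_measurable M"
  unfolding sign_flip_def by (intro measurable_If_set) auto

text \<open>
  The sign functions of a halving system are orthogonal on \<open>A\<close>: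
  \<open>\<integral>\<^sub>A r\<^sub>m r\<^sub>n = \<mu>(A) - 2\<mu>(E\<^sub>m) - 2\<mu>(E\<^sub>n) + 4\<mu>(E\<^sub>m \<inter> E\<^sub>n)\<close>.  Only the diagonal terms of the square
  survive integration.
\<close>

lemma second_moment_sum_sign_flip:
  assumes A: "A \<in> fmeasurable M" and HS: "halving_system M A E" and s: "inj s"
  shows "set_integrable M A (\<lambda>x. (\<Sum>k<N. sign_flip (E (s k)) x)\<^sup>2)"
    and "(LINT x:A|M. (\<Sum>k<N. sign_flip (E (s k)) x)\<^sup>2) = real N * measure M A"
proof -
  have E: "\<And>n. E n \<in> sets M" "\<And>n. E n \<subseteq> A" "\<And>n. measure M (E n) = measure M A / 2"
    "\<And>m n. m \<noteq> n \<Longrightarrow> measure M (E m \<inter> E n) = measure M A / 4"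
    using HS by (auto simp only: halving_system_def)
  have [simp]: "integrable M (indicat_real B)" "B \<inter> space M = B" "B \<in> sets M"
    if "B \<in> sets M" "B \<subseteq> A" for B
    using that A fmeasurableI2[OF A that(2,1)] sets.sets_into_space[OF that(1)]
    by (auto simp: fmeasurable_def)
  have A': "A \<in> sets M" using A by auto
  have [simp]: "E m \<inter> E n \<in> sets M" "E m \<inter> E n \<subseteq> A" for m n using E by auto
  have prod: "indicat_real A x * (sign_flip (E m) x * sign_flip (E n) x) =
     indicator A x - 2 * indicator (E m) x - 2 * indicator (E n) x + 4 * indicator (E m \<inter> E n) x" for m n x
    using E(2)[of m] E(2)[of n] by (auto simp: sign_flip_def indicator_def)
  have int: "integrable M (\<lambda>x. indicat_real A x * (sign_flip (E m) x * sign_flip (E n) x))" for m n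
    unfolding prod using E A' by (intro Bochner_Integration.integrable_add Bochner_Integration.integrable_diff integrable_mult_right) auto
  have val: "(\<integral>x. indicat_real A x * (sign_flip (E m) x * sign_flip (E n) x) \<partial>M)
     = (if m = n then measure M A else 0)" for m n
  proof -
    have "(\<integral>x. indicat_real A x * (sign_flip (E m) x * sign_flip (E n) x) \<partial>M) =
        measure M A - 2 * measure M (E m) - 2 * measure M (E n) + 4 * measure M (E m \<inter> E n)"
      unfolding prod using E(1,2) A'
      by (subst Bochner_Integration.integral_add Bochner_Integration.integral_diff,
          auto intro!: Bochner_Integration.integrable_diff)+
    then show ?thesis using E(3)[of m] E(3)[of n] E(4)[of m n] by auto
  qed
  have sq: "indicat_real A x *\<^sub>R (\<Sum>k<N. sign_flip (E (s k)) x)\<^sup>2 =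
     (\<Sum>j<N. \<Sum>k<N. indicat_real A x * (sign_flip (E (s j)) x * sign_flip (E (s k)) x))" for x
    unfolding power2_eq_square sum_product[of "\<lambda>k. sign_flip (E (s k)) x"] real_scaleR_def
    unfolding sum_distrib_left ..
  show "set_integrable M A (\<lambda>x. (\<Sum>k<N. sign_flip (E (s k)) x)\<^sup>2)"
    unfolding set_integrable_def sq by (intro Bochner_Integration.integrable_sum int)
  show "(LINT x:A|M. (\<Sum>k<N. sign_flip (E (s k)) x)\<^sup>2) = real N * measure M A"
  proof -
    have "(LINT x:A|M. (\<Sum>k<N. sign_flip (E (s k)) x)\<^sup>2) =
        (\<Sum>j<N. \<Sum>k<N. if s j = s k then measure M A else 0)"
      unfolding set_lebesgue_integral_def sq
      by (simp only: Bochner_Integration.integral_sum Bochner_Integration.integrable_sum int val)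
    then show ?thesis by (simp add: inj_eq[OF s])
  qed
qed

lemma bounded_off_small_set:
  assumes A: "A \<in> fmeasurable M" and [measurable]: "y \<in> borel_measurable M" and "e > 0"
  shows "\<exists>R>0::real. measure M {x \<in> A. R \<le> y x} < e"
proof -
  have A': "A \<in> sets M" using A by auto
  have sets: "{x \<in> A. real n \<le> y x} \<in> sets M" for n
  proof -
    have "{x \<in> A. real n \<le> y x} = A \<inter> {x \<in> space M. real n \<le> y x}"
      using sets.sets_into_space[OF A'] by auto
    then show ?thesis using A' by simp
  qed
  have "(\<lambda>n. measure M {x \<in> A. real n \<le> y x}) \<longlonglongrightarrow> measure M (\<Inter>n. {x \<in> A. real n \<le> y x})"
  proof (rule Lim_measure_decseq)
    show "emeasure M {x \<in> A. real n \<le> y x} \<noteq> \<infinity>" for n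
      using fmeasurableI2[OF A _ sets, of n] by (auto simp: fmeasurable_def)
    show "decseq (\<lambda>n. {x \<in> A. real n \<le> y x})"
      by (auto simp: decseq_def intro: order_trans[rotated])
  qed (use sets in auto)
  also have "(\<Inter>n. {x \<in> A. real n \<le> y x}) = {}"
  proof -
    have "\<exists>n. \<not> real n \<le> y x" for x using reals_Archimedean2[of "y x"] by (simp add: not_le)
    then show ?thesis by blast
  qed
  finally have "eventually (\<lambda>n. measure M {x \<in> A. real n \<le> y x} < e) sequentially"
    using \<open>e > 0\<close> by (simp add: order_tendstoD)
  then have "eventually (\<lambda>n. n > 0 \<and> measure M {x \<in> A. real n \<le> y x} < e) sequentially"
    by (intro eventually_conj eventually_gt_at_top)
  then obtain n where "n > 0" "measure M {x \<in> A. real n \<le> y x} < e"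
    using eventually_happens'[OF sequentially_bot] by blast
  then show ?thesis by (intro exI[of _ "real n"]) auto
qed

text \<open>
  Off a small set \<open>y\<close> is bounded by some \<open>R\<close>; there the product can be large only where the
  average exceeds \<open>e / R\<close>, and Chebyshev's inequality with the second moment bounds that set by
  \<open>O(1 / N)\<close>.
\<close>

lemma averages_small_in_measure:
  assumes A: "A \<in> fmeasurable M" and HS: "halving_system M A E" and s: "inj s" and y [measurable]: "y \<in> borel_measurable M" and "e > 0"
  shows "\<exists>N>0. measure M {x \<in> A. e \<le> y x * \<bar>(\<Sum>k<N. sign_flip (E (s k)) x) / real N\<bar>} < e"
proof -
  have A': "A \<in> sets M" using A by auto
  have [measurable]: "E n \<in> sets M" for n using HS by (simp add: halving_system_def)
  have sets: "{x \<in> A. c \<le> f x} \<in> fmeasurable M" if [measurable]: "f \<in> borel_measurable M"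
    for c :: real and f
  proof -
    have "{x \<in> A. c \<le> f x} = A \<inter> {x \<in> space M. c \<le> f x}"
      using sets.sets_into_space[OF A'] by auto
    then have "{x \<in> A. c \<le> f x} \<in> sets M" using A' by simp
    then show ?thesis by (rule fmeasurableI2[OF A Collect_restrict])
  qed
  obtain R where R: "R > 0" "measure M {x \<in> A. R \<le> y x} < e / 2"
    using bounded_off_small_set[OF A y, of "e/2"] \<open>e > 0\<close> by auto
  define d where "d = e / R"
  have "d > 0" using R \<open>e > 0\<close> by (simp add: d_def)
  obtain N :: nat where N: "N > 0" "2 * measure M A / (e * d\<^sup>2) < real N"
  proof -
    obtain n where "2 * measure M A / (e * d\<^sup>2) < real n" using reals_Archimedean2 by blast
    then show thesis by (intro that[of "Suc n"]) auto
  qed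
  define a where "a x = (\<Sum>k<N. sign_flip (E (s k)) x) / real N" for x
  have [measurable]: "a \<in> borel_measurable M" unfolding a_def by measurable
  have "measure M {x \<in> A. d\<^sup>2 * (real N)\<^sup>2 \<le> (\<Sum>k<N. sign_flip (E (s k)) x)\<^sup>2}
      \<le> (real N * measure M A) / (d\<^sup>2 * (real N)\<^sup>2)"
    using integral_Markov_inequality'_measure[OF second_moment_sum_sign_flip(1)[OF A HS s, where N = N] A',
        where c = "d\<^sup>2 * (real N)\<^sup>2"]
      second_moment_sum_sign_flip(2)[OF A HS s, where N = N] \<open>d > 0\<close> N by simp
  also have "\<dots> = measure M A / (d\<^sup>2 * real N)"
    using N by (simp add: power2_eq_square)
  also have "\<dots> < e / 2"
    using N \<open>d > 0\<close> \<open>e > 0\<close> by (simp add: field_simps)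
  also have "{x \<in> A. d\<^sup>2 * (real N)\<^sup>2 \<le> (\<Sum>k<N. sign_flip (E (s k)) x)\<^sup>2} = {x \<in> A. d \<le> \<bar>a x\<bar>}"
  proof -
    have "d\<^sup>2 * (real N)\<^sup>2 \<le> v\<^sup>2 \<longleftrightarrow> d \<le> \<bar>v / real N\<bar>" for v :: real
    proof -
      have "d\<^sup>2 * (real N)\<^sup>2 \<le> v\<^sup>2 \<longleftrightarrow> \<bar>d * real N\<bar> \<le> \<bar>v\<bar>"
        by (simp only: power_mult_distrib[symmetric] abs_le_square_iff)
      then show ?thesis using N \<open>d > 0\<close> by (simp add: field_simps)
    qed
    then show ?thesis by (simp add: a_def)
  qed
  finally have a: "measure M {x \<in> A. d \<le> \<bar>a x\<bar>} < e / 2" .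
  have "{x \<in> A. e \<le> y x * \<bar>a x\<bar>} \<subseteq> {x \<in> A. R \<le> y x} \<union> {x \<in> A. d \<le> \<bar>a x\<bar>}"
  proof (rule subsetI, rule ccontr)
    fix x assume x: "x \<in> {x \<in> A. e \<le> y x * \<bar>a x\<bar>}" "x \<notin> {x \<in> A. R \<le> y x} \<union> {x \<in> A. d \<le> \<bar>a x\<bar>}"
    then have "y x \<le> R" "\<bar>a x\<bar> < d" by auto
    then have "y x * \<bar>a x\<bar> < R * d"
      using R by (meson abs_ge_zero le_less_trans mult_right_mono mult_strict_left_mono)
    with x R show False by (simp add: d_def)
  qed
  then have "measure M {x \<in> A. e \<le> y x * \<bar>a x\<bar>} \<le> measure M ({x \<in> A. R \<le> y x} \<union> {x \<in> A. d \<le> \<bar>a x\<bar>})"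
    by (intro measure_mono_fmeasurable fmeasurable.Un fmeasurableD sets) measurable
  also have "\<dots> \<le> measure M {x \<in> A. R \<le> y x} + measure M {x \<in> A. d \<le> \<bar>a x\<bar>}"
    by (intro measure_Un_le fmeasurableD sets) measurable
  also have "\<dots> < e" using R a by simp
  finally show ?thesis using N(1) by (auto simp: a_def)
qed

section \<open>Norms on Koethe spaces\<close>

context koethe_space
begin

lemma mem_measurable: "f \<in> X \<Longrightarrow> f \<in> borel_measurable M"
  using subset_L0 by (auto simp: L0_def)

lemma zero_nrm: "nrm (\<lambda>x. 0) = 0"
  using nrm_eq_0_iff[OF zero_mem] by simp

lemma diff_mem: "f \<in> X \<Longrightarrow> g \<in> X \<Longrightarrow> (\<lambda>x. f x - g x) \<in> X"
  using add_mem[OF _ scale_mem[of g "-1"], of f] by simp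

lemma nrm_minus_commute:
  assumes "f \<in> X" "g \<in> X" shows "nrm (\<lambda>x. f x - g x) = nrm (\<lambda>x. g x - f x)"
  using nrm_scale[OF diff_mem[OF assms], of "-1"] by simp

lemma nrm_mono:
  "g \<in> X \<Longrightarrow> f \<in> borel_measurable M \<Longrightarrow> (\<And>x. norm (f x) \<le> norm (g x)) \<Longrightarrow> f \<in> X"
  "g \<in> X \<Longrightarrow> f \<in> borel_measurable M \<Longrightarrow> (\<And>x. norm (f x) \<le> norm (g x)) \<Longrightarrow> nrm f \<le> nrm g"
  using ideal[of g f] by auto

lemma nrm_sum:
  assumes "finite I" "\<And>i. i \<in> I \<Longrightarrow> a i \<in> X"
  shows "(\<lambda>x. \<Sum>i\<in>I. a i x) \<in> X" "nrm (\<lambda>x. \<Sum>i\<in>I. a i x) \<le> (\<Sum>i\<in>I. nrm (a i))"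
proof -
  have "(\<lambda>x. \<Sum>i\<in>I. a i x) \<in> X \<and> nrm (\<lambda>x. \<Sum>i\<in>I. a i x) \<le> (\<Sum>i\<in>I. nrm (a i))"
    using assms
  proof (induction I rule: finite_induct)
    case empty
    then show ?case using zero_mem zero_nrm by simp
  next
    case (insert i I)
    then have i: "a i \<in> X" and I: "(\<lambda>x. \<Sum>i\<in>I. a i x) \<in> X"
      "nrm (\<lambda>x. \<Sum>i\<in>I. a i x) \<le> (\<Sum>i\<in>I. nrm (a i))" by auto
    show ?case
      using add_mem[OF i I(1)] nrm_triangle[OF i I(1)] I(2) insert.hyps by simp
  qed
  then show "(\<lambda>x. \<Sum>i\<in>I. a i x) \<in> X" "nrm (\<lambda>x. \<Sum>i\<in>I. a i x) \<le> (\<Sum>i\<in>I. nrm (a i))" by auto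
qed

text \<open>
  In a Banach space absolutely convergent series converge; this makes the gliding sum in
  \<open>multiplier_bounded\<close> available.
\<close>

lemma absolutely_summable_limit:
  assumes a: "\<And>i. a i \<in> X" and sum: "summable (\<lambda>i. nrm (a i))"
  shows "\<exists>F\<in>X. (\<lambda>n. nrm (\<lambda>x. (\<Sum>i<n. a i x) - F x)) \<longlonglongrightarrow> 0"
proof (rule nrm_complete)
  fix e :: real assume "e > 0"
  then obtain n0 where n0: "\<And>m n. m \<ge> n0 \<Longrightarrow> norm (\<Sum>i=m..<n. nrm (a i)) < e"
    using sum unfolding summable_Cauchy by blast
  have S: "(\<lambda>x. \<Sum>i<n. a i x) \<in> X" for n using a by (intro nrm_sum) auto
  have le: "nrm (\<lambda>x. (\<Sum>i<n. a i x) - (\<Sum>i<m. a i x)) < e" if "n0 \<le> m" "m \<le> n" for m n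
  proof -
    have "(\<Sum>i<n. a i x) - (\<Sum>i<m. a i x) = (\<Sum>i=m..<n. a i x)" for x
      using sum_diff_nat_ivl[of 0 m n "\<lambda>i. a i x"] that by (simp add: lessThan_atLeast0)
    then have "nrm (\<lambda>x. (\<Sum>i<n. a i x) - (\<Sum>i<m. a i x)) \<le> (\<Sum>i=m..<n. nrm (a i))"
      using nrm_sum(2)[of "{m..<n}" a] a by simp
    with n0[OF that(1), of n] show ?thesis by simp
  qed
  have "nrm (\<lambda>x. (\<Sum>i<m. a i x) - (\<Sum>i<n. a i x)) < e" if "n0 \<le> m" "n0 \<le> n" for m n
    using le[of m n] le[of n m] that nrm_minus_commute[OF S S, of m n] by (cases "m \<le> n") auto
  then show "\<exists>n0. \<forall>m\<ge>n0. \<forall>n\<ge>n0. nrm (\<lambda>x. (\<Sum>i<m. a i x) - (\<Sum>i<n. a i x)) < e" by blast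
qed (use a in \<open>auto intro!: nrm_sum\<close>)

text \<open>
  Norm limits respect the pointwise order: the positive part of \<open>|S m| - |F|\<close> is dominated by
  \<open>|S n - F|\<close> for every \<open>n \<ge> m\<close>, so its norm is \<open>0\<close>.
\<close>

lemma AE_le_norm_limit:
  assumes S: "\<And>n. S n \<in> X" and F: "F \<in> X" and mono: "\<And>m n x. m \<le> n \<Longrightarrow> norm (S m x) \<le> norm (S n x)"
    and lim: "(\<lambda>n. nrm (\<lambda>x. S n x - F x)) \<longlonglongrightarrow> 0"
  shows "AE x in M. norm (S m x) \<le> norm (F x)"
proof -
  note [measurable] = mem_measurable[OF S] mem_measurable[OF F]
  define P where "P x = (of_real (max 0 (norm (S m x) - norm (F x))) :: 'k)" for x
  have [measurable]: "P \<in> borel_measurable M" unfolding P_def by measurable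
  have P: "norm (P x) \<le> norm (S n x - F x)" if "m \<le> n" for n x
    using norm_triangle_ineq2[of "S n x" "F x"] mono[OF that, of x] by (simp add: P_def)
  have PX: "P \<in> X" by (rule nrm_mono(1)[OF diff_mem[OF S[of m] F]]) (use P in auto)
  have "nrm P \<le> nrm (\<lambda>x. S n x - F x)" if "m \<le> n" for n
    by (rule nrm_mono(2)[OF diff_mem[OF S[of n] F]]) (use P[OF that] in auto)
  then have "nrm P \<le> 0" by (intro LIMSEQ_le_const[OF lim]) auto
  with nrm_nonneg[OF PX] nrm_eq_0_iff[OF PX] have "AE x in M. P x = 0" by simp
  then show ?thesis
    by eventually_elim (auto simp: P_def max_def split: if_splits)
qed

text \<open>
  The Fatou property in the form in which it is used: a basic neighbourhood of \<open>g\<close> in the topology of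
  local convergence in measure misses the ball of radius \<open>C\<close>.  The property itself is about
  the unit ball, so \<open>g\<close> is divided by \<open>C\<close> first.
\<close>

lemma closed_ball_closed_in_measure:
  assumes fatou: "fatou_property M X nrm" and g: "g \<in> X" and C: "C > 0" "nrm g > C"
  obtains A d where "A \<in> fmeasurable M" "d > 0"
    "\<And>w. w \<in> X \<Longrightarrow> nrm w \<le> C \<Longrightarrow> measure M {x \<in> A. norm (w x - g x) \<ge> d} \<ge> d"
proof -
  define B where "B = {f \<in> X. nrm f \<le> 1}"
  define h where "h x = inverse (of_real C) * g x" for x
  have norm_c: "norm (inverse (of_real C :: 'k)) = inverse C" using C by (simp add: norm_inverse)
  have h: "h \<in> X" "nrm h = nrm g / C"
    unfolding h_def using scale_mem[OF g] nrm_scale[OF g, of "inverse (of_real C)"] norm_c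
    by (simp_all only: divide_inverse_commute)
  have op: "local_measure_open M (topspace (local_measure_topology M) - B)"
    using fatou by (auto simp: fatou_property_def closedin_def openin_local_measure_topology B_def)
  have "local_measure_open M (L0 M :: ('a \<Rightarrow> 'k) set)"
    unfolding local_measure_open_def by (auto intro!: bexI[of _ "{}"] exI[of _ 1])
  then have "L0 M \<subseteq> topspace (local_measure_topology M :: ('a \<Rightarrow> 'k) topology)"
    by (intro openin_subset) (simp add: openin_local_measure_topology)
  moreover have "nrm h > 1" using h C by simp
  ultimately have "h \<in> topspace (local_measure_topology M) - B"
    using h subset_L0 by (auto simp: B_def)
  then obtain A d where A: "A \<in> sets M" "emeasure M A < \<infinity>" "d > 0"
      "{f \<in> L0 M. measure M {x \<in> A. norm (f x - h x) \<ge> d} < d} \<subseteq> topspace (local_measure_topology M) - B"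
    using op unfolding local_measure_open_def by blast
  have fA: "A \<in> fmeasurable M" using A by (auto simp: fmeasurable_def)
  have key: "measure M {x \<in> A. norm (w x - g x) \<ge> d * C} \<ge> d" if w: "w \<in> X" "nrm w \<le> C" for w
  proof (rule ccontr)
    define v where "v x = inverse (of_real C) * w x" for x
    have v: "v \<in> X" "nrm v = nrm w / C"
      unfolding v_def using scale_mem[OF w(1)] nrm_scale[OF w(1), of "inverse (of_real C)"] norm_c
      by (simp_all only: divide_inverse_commute)
    then have "v \<in> B" using w C by (simp add: B_def)
    have "norm (v x - h x) = norm (w x - g x) / C" for x
      unfolding v_def h_def right_diff_distrib[symmetric] norm_mult norm_c by (simp add: field_simps)
    then have "{x \<in> A. norm (v x - h x) \<ge> d} = {x \<in> A. norm (w x - g x) \<ge> d * C}"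
      using C by (simp add: le_divide_eq)
    moreover assume "\<not> measure M {x \<in> A. norm (w x - g x) \<ge> d * C} \<ge> d"
    ultimately have "v \<notin> B" using A(4) v(1) subset_L0 by auto
    with \<open>v \<in> B\<close> show False by simp
  qed
  \<comment> \<open>Undoing the scaling changes only the threshold for the values; one constant serves for both.\<close>
  define c where "c = min d (d * C)"
  show thesis
  proof (rule that[OF fA])
    show "c > 0" using A C by (simp add: c_def)
    fix w assume w: "w \<in> X" "nrm w \<le> C"
    have [measurable]: "w \<in> borel_measurable M" "g \<in> borel_measurable M" "A \<in> sets M"
      using w g A mem_measurable by auto
    have sets: "{x \<in> A. norm (w x - g x) \<ge> b} \<in> sets M" for b
    proof -
      have "{x \<in> A. norm (w x - g x) \<ge> b} = A \<inter> {x \<in> space M. norm (w x - g x) \<ge> b}"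
        using sets.sets_into_space[OF A(1)] by auto
      then show ?thesis by simp
    qed
    have "measure M {x \<in> A. norm (w x - g x) \<ge> d * C} \<le> measure M {x \<in> A. norm (w x - g x) \<ge> c}"
      by (intro measure_mono_fmeasurable sets fmeasurableI2[OF fA Collect_restrict sets])
        (auto simp: c_def)
    with key[OF w] show "measure M {x \<in> A. norm (w x - g x) \<ge> c} \<ge> c"
      by (simp add: c_def)
  qed
qed

text \<open>
  The averaging argument.  Given a norm bound for \<open>r\<^sub>n g - y\<close> along a subsequence of signs, multiply by
  \<open>r\<^sub>n\<close> again and average: the functions \<open>g - a y\<close>, with \<open>a\<close> an average of signs, obey the same bound
  and approximate \<open>g\<close> in measure.  The set \<open>A\<close> on which the signs have to average out is
  supplied by the Fatou property, so the signs may depend on it.  An arbitrary sequence of measurable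
  sets is admitted in the hypothesis because compactness will provide the subsequence for any of them.
\<close>

lemma norm_le_of_sign_flips:
  assumes fatou: "fatou_property M X nrm" and na: "non_atomic M" and g: "g \<in> X" and c: "0 \<le> c"
    and flips: "\<And>E. (\<And>n. E n \<in> sets M) \<Longrightarrow> \<exists>s. inj s \<and> (\<exists>y\<in>X. \<forall>k::nat.
        nrm (\<lambda>x. of_real (sign_flip (E (s k :: nat)) x) * g x - y x) \<le> c)"
  shows "nrm g \<le> c"
proof (rule ccontr)
  assume "\<not> nrm g \<le> c"
  define C where "C = (c + nrm g) / 2"
  have C: "C > 0" "nrm g > C" "c \<le> C" using c \<open>\<not> nrm g \<le> c\<close> by (auto simp: C_def)
  obtain A d where A: "A \<in> fmeasurable M" "d > 0"
    and far: "\<And>w. w \<in> X \<Longrightarrow> nrm w \<le> C \<Longrightarrow> measure M {x \<in> A. norm (w x - g x) \<ge> d} \<ge> d"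
    using closed_ball_closed_in_measure[OF fatou g C(1,2)] by blast
  obtain E where HS: "halving_system M A E"
    using halving_system_exists[OF na A(1)] ..
  then have E: "E n \<in> sets M" for n by (simp add: halving_system_def)
  obtain s :: "nat \<Rightarrow> nat" and y where s: "inj s" and y: "y \<in> X"
    and le: "\<And>k. nrm (\<lambda>x. of_real (sign_flip (E (s k)) x) * g x - y x) \<le> c"
    using flips[of E] E by blast
  note [measurable] = E mem_measurable[OF g] mem_measurable[OF y]
  define r where "r k = sign_flip (E (s k))" for k
  have [measurable]: "r k \<in> borel_measurable M" for k unfolding r_def by measurable
  have r: "r k x * r k x = 1" "\<bar>r k x\<bar> = 1" for k x by (auto simp: r_def sign_flip_def)
  have flip_g: "(\<lambda>x. of_real (r k x) * g x) \<in> X" for k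
    by (rule nrm_mono(1)[OF g]) (auto simp: norm_mult r)
  obtain N where N: "N > 0" "measure M {x \<in> A. d \<le> norm (y x) * \<bar>(\<Sum>k<N. r k x) / real N\<bar>} < d"
    using averages_small_in_measure[OF A(1) HS s, of "\<lambda>x. norm (y x)" d] A(2) unfolding r_def by auto
  define h where "h k x = of_real (r k x) * g x - y x" for k x
  define a where "a k x = of_real (r k x / N) * h k x" for k x
  have h: "h k \<in> X" "nrm (h k) \<le> c" for k
    unfolding h_def using diff_mem[OF flip_g y] le by (auto simp: r_def)
  note [measurable] = mem_measurable[OF h(1)]
  have a: "a k \<in> X" "nrm (a k) \<le> c / N" for k
  proof -
    have sc: "(\<lambda>x. of_real (1 / N) * h k x) \<in> X" "nrm (\<lambda>x. of_real (1 / N) * h k x) = 1 / N * nrm (h k)"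
      using scale_mem[OF h(1), of "of_real (1 / N)"] nrm_scale[OF h(1), of "of_real (1 / N)"]
      by (simp_all add: norm_divide)
    have le: "norm (a k x) \<le> norm (of_real (1 / N) * h k x)" for x
      by (simp add: a_def norm_mult norm_divide r)
    have [measurable]: "a k \<in> borel_measurable M" unfolding a_def by measurable
    show "a k \<in> X" by (rule nrm_mono(1)[OF sc(1)]) (use le in auto)
    have "nrm (a k) \<le> 1 / N * nrm (h k)"
      unfolding sc(2)[symmetric] by (rule nrm_mono(2)[OF sc(1)]) (use le in auto)
    also have "\<dots> \<le> c / N" using h(2)[of k] N by (simp add: divide_right_mono)
    finally show "nrm (a k) \<le> c / N" .
  qed
  \<comment> \<open>Since the squares of the signs are \<open>1\<close>, this sum is \<open>g\<close> minus the average of the signs times \<open>y\<close>.\<close>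
  define w where "w x = (\<Sum>k<N. a k x)" for x
  have w: "w \<in> X" unfolding w_def using a by (intro nrm_sum) auto
  have "nrm w \<le> (\<Sum>k<N. nrm (a k))" unfolding w_def using a by (intro nrm_sum) auto
  also have "\<dots> \<le> (\<Sum>k<N. c / N)" by (intro sum_mono a)
  also have "\<dots> = c" using N by simp
  finally have "nrm w \<le> C" using C by simp
  have "a k x = of_real (1 / N) * g x - of_real (r k x / N) * y x" for k x
  proof -
    have "of_real (r k x / N) * (of_real (r k x) * g x) = of_real (r k x * r k x / N) * g x"
      by simp
    then show ?thesis by (simp add: a_def h_def right_diff_distrib r)
  qed
  then have "w x = g x - of_real ((\<Sum>k<N. r k x) / N) * y x" for x
    using N by (simp add: w_def sum_subtractf sum_distrib_right sum_divide_distrib)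
  then have "norm (w x - g x) = norm (y x) * \<bar>(\<Sum>k<N. r k x) / real N\<bar>" for x
    by (simp only: diff_diff_eq2 norm_minus_commute[of _ "g x"] norm_mult norm_of_real)
      (simp add: norm_mult norm_of_real del: of_real_divide of_real_sum)
  with far[OF w \<open>nrm w \<le> C\<close>] N(2) show False by simp
qed

end

section \<open>Boundedness of multiplication operators and compact operators\<close>

text \<open>
  Gliding sum in place of the closed graph theorem: if \<open>\<parallel>l f\<^sub>n\<parallel> > 4\<^sup>n\<close> with \<open>\<parallel>f\<^sub>n\<parallel> \<le> 1\<close>, the series
  \<open>\<Sum> 2\<^sup>-\<^sup>n |f\<^sub>n|\<close> converges to some \<open>F\<close> in \<open>X\<close> that dominates each of its terms, so the norm of
  \<open>l F\<close> is at least \<open>2\<^sup>-\<^sup>n 4\<^sup>n = 2\<^sup>n\<close> for every \<open>n\<close>.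
\<close>

lemma multiplier_bounded:
  fixes X Y :: "('a \<Rightarrow> 'k::{real_normed_field, euclidean_space}) set"
  assumes X: "koethe_space M X nX" and Y: "koethe_space M Y nY" and l: "l \<in> multipliers M X Y"
  shows "\<exists>C. \<forall>f\<in>X. nX f \<le> 1 \<longrightarrow> nY (\<lambda>x. l x * f x) \<le> C"
proof (rule ccontr)
  interpret X: koethe_space M X nX by fact
  interpret Y: koethe_space M Y nY by fact
  have lY: "(\<lambda>x. l x * f x) \<in> Y" if "f \<in> X" for f
    using l that by (auto simp: multipliers_def mult.commute)
  assume "\<not> ?thesis"
  then have "\<forall>n::nat. \<exists>f\<in>X. nX f \<le> 1 \<and> nY (\<lambda>x. l x * f x) > 4 ^ n" by (meson not_le)
  then obtain f where f: "\<And>n. f n \<in> X" "\<And>n. nX (f n) \<le> 1" "\<And>n. nY (\<lambda>x. l x * f n x) > 4 ^ n"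
    by metis
  note [measurable] = X.mem_measurable[OF f(1)]
  define a where "a n x = (of_real ((1/2) ^ n * norm (f n x)) :: 'k)" for n x
  have a: "a n \<in> X" "nX (a n) \<le> (1/2) ^ n" for n
  proof -
    have sc: "(\<lambda>x. of_real ((1/2) ^ n) * f n x) \<in> X" "nX (\<lambda>x. of_real ((1/2) ^ n) * f n x) = (1/2) ^ n * nX (f n)"
      using X.scale_mem[OF f(1)] X.nrm_scale[OF f(1), of "of_real ((1/2) ^ n)"]
      by (simp_all add: norm_power norm_divide)
    have [measurable]: "a n \<in> borel_measurable M" unfolding a_def by measurable
    have le: "norm (a n x) \<le> norm (of_real ((1/2) ^ n) * f n x)" for x
      by (simp add: a_def norm_mult norm_power norm_divide)
    show "a n \<in> X" by (rule X.nrm_mono(1)[OF sc(1)]) (use le in auto)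
    have "nX (a n) \<le> (1/2) ^ n * nX (f n)"
      unfolding sc(2)[symmetric] by (rule X.nrm_mono(2)[OF sc(1)]) (use le in auto)
    also have "\<dots> \<le> (1/2) ^ n" using f(2)[of n] by (intro mult_left_le) auto
    finally show "nX (a n) \<le> (1/2) ^ n" .
  qed
  have "summable (\<lambda>n. nX (a n))"
    by (rule summable_comparison_test'[of "\<lambda>n. (1/2) ^ n" 0]) (use a X.nrm_nonneg in auto)
  then obtain F where F: "F \<in> X" "(\<lambda>n. nX (\<lambda>x. (\<Sum>i<n. a i x) - F x)) \<longlonglongrightarrow> 0"
    using X.absolutely_summable_limit a by blast
  have S: "(\<Sum>i<n. a i x) = of_real (\<Sum>i<n. (1/2) ^ i * norm (f i x))" for n x
    by (simp add: a_def)
  have nS: "norm (\<Sum>i<n. a i x) = (\<Sum>i<n. (1/2) ^ i * norm (f i x))" for n x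
    unfolding S norm_of_real by (simp add: sum_nonneg)
  have dom: "AE x in M. norm (\<Sum>i<n. a i x) \<le> norm (F x)" for n
    by (rule X.AE_le_norm_limit[OF _ F(1) _ F(2)]) (auto intro!: X.nrm_sum a sum_mono2 simp: nS)
  have big: "2 ^ n \<le> nY (\<lambda>x. l x * F x)" for n
  proof -
    have [measurable]: "l \<in> borel_measurable M" using l by (auto simp: multipliers_def L0_def)
    have "nY (\<lambda>x. of_real ((1/2) ^ n) * (l x * f n x)) \<le> nY (\<lambda>x. l x * F x)"
    proof (rule Y.ideal[OF lY[OF F(1)], THEN conjunct2])
      show "AE x in M. norm (of_real ((1/2) ^ n) * (l x * f n x)) \<le> norm (l x * F x)"
        using dom[of "Suc n"]
      proof eventually_elim
        case (elim x)
        have "(1/2) ^ n * norm (f n x) \<le> norm (F x)"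
          using elim sum_nonneg[of "{..<n}" "\<lambda>i. (1/2) ^ i * norm (f i x)"] unfolding nS by simp
        then have "norm (l x) * ((1/2) ^ n * norm (f n x)) \<le> norm (l x) * norm (F x)"
          by (intro mult_left_mono) auto
        then show ?case by (simp add: norm_mult norm_power norm_divide mult_ac)
      qed
    qed measurable
    moreover have "nY (\<lambda>x. of_real ((1/2) ^ n) * (l x * f n x)) = (1/2) ^ n * nY (\<lambda>x. l x * f n x)"
      using Y.nrm_scale[OF lY[OF f(1)], of "of_real ((1/2) ^ n)"] by (simp add: norm_power norm_divide)
    moreover have "(1/2) ^ n * (4::real) ^ n \<le> (1/2) ^ n * nY (\<lambda>x. l x * f n x)"
      using f(3)[of n] by (intro mult_left_mono) auto
    moreover have "(1/2) ^ n * (4::real) ^ n = 2 ^ n" by (simp flip: power_mult_distrib)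
    ultimately show ?thesis by simp
  qed
  obtain n where "nY (\<lambda>x. l x * F x) < 2 ^ n" using real_arch_pow[of 2] by auto
  with big[of n] show False by simp
qed

lemma compact_operator_subsequence:
  assumes K: "compact_operator M X nX Y nY K" and F: "\<And>n :: nat. F n \<in> X" "\<And>n. nX (F n) \<le> 1"
  shows "\<exists>r. strict_mono r \<and> (\<exists>y\<in>Y. (\<lambda>n. nY (\<lambda>x. K (F (r n)) x - y x)) \<longlonglongrightarrow> 0)"
proof -
  from K have "\<forall>F :: nat \<Rightarrow> 'a \<Rightarrow> 'b. (\<forall>n. F n \<in> X \<and> nX (F n) \<le> 1) \<longrightarrow>
      (\<exists>r. strict_mono r \<and> (\<exists>y\<in>Y. (\<lambda>n. nY (\<lambda>x. K (F (r n)) x - y x)) \<longlonglongrightarrow> 0))"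
    unfolding compact_operator_def by (rule conjunct2)
  from spec[OF this, of F] show ?thesis by (rule mp) (simp add: F)
qed

lemma compact_operator_bounded:
  fixes X Y :: "('a \<Rightarrow> 'k::{real_normed_field, euclidean_space}) set"
  assumes Y: "koethe_space M Y nY" and K: "compact_operator M X nX Y nY K"
  shows "\<exists>C. \<forall>f\<in>X. nX f \<le> 1 \<longrightarrow> nY (K f) \<le> C"
proof (rule ccontr)
  interpret Y: koethe_space M Y nY by fact
  assume "\<not> ?thesis"
  then have "\<forall>n::nat. \<exists>f\<in>X. nX f \<le> 1 \<and> nY (K f) > real n" by (meson not_le)
  then obtain f where f: "\<And>n. f n \<in> X" "\<And>n. nX (f n) \<le> 1" "\<And>n. nY (K (f n)) > real n"
    by metis
  obtain r where r: "strict_mono r \<and> (\<exists>y\<in>Y. (\<lambda>n. nY (\<lambda>x. K (f (r n)) x - y x)) \<longlonglongrightarrow> 0)"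
    using compact_operator_subsequence[OF K f(1,2)] ..
  then obtain y where y: "y \<in> Y" and lim: "(\<lambda>n. nY (\<lambda>x. K (f (r n)) x - y x)) \<longlonglongrightarrow> 0"
    by (auto elim: bexE)
  from r have r: "strict_mono r" ..
  have Kf: "K (f n) \<in> Y" for n using K f(1) by (auto simp: compact_operator_def linear_operator_def)
  have "nY (K (f (r n))) \<le> nY (\<lambda>x. K (f (r n)) x - y x) + nY y" for n
    using Y.nrm_triangle[OF Y.diff_mem[OF Kf y] y] by simp
  then have le: "real n - nY y \<le> nY (\<lambda>x. K (f (r n)) x - y x)" for n
    using f(3)[of "r n"] strict_mono_imp_increasing[OF r, of n] by (meson diff_le_eq le_less_trans
      less_imp_le of_nat_mono order_trans)
  have "eventually (\<lambda>n. nY (\<lambda>x. K (f (r n)) x - y x) < 1) sequentially"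
    by (rule order_tendstoD(2)[OF lim]) simp
  then obtain n0 where n0: "\<And>n. n \<ge> n0 \<Longrightarrow> nY (\<lambda>x. K (f (r n)) x - y x) < 1"
    by (auto simp: eventually_sequentially)
  obtain m :: nat where m: "nY y + 1 \<le> real m" using real_arch_simple by blast
  have "real (max n0 m) - nY y < 1"
    using le[of "max n0 m"] n0[of "max n0 m"] by simp
  with m show False by simp
qed

section \<open>The essential norm\<close>

text \<open>
  For signs \<open>r\<^sub>n\<close> the functions \<open>r\<^sub>n f\<close> lie in the unit ball, and \<open>K (r\<^sub>n f) \<rightarrow> y\<close> along a
  subsequence.  As \<open>M\<^sub>l\<close> commutes with multiplication by signs, \<open>r\<^sub>n (l f) - y\<close> is the sum of
  \<open>(M\<^sub>l - K) (r\<^sub>n f)\<close> and \<open>K (r\<^sub>n f) - y\<close>.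
\<close>

lemma norm_mult_op_le_of_compact:
  fixes X Y :: "('a \<Rightarrow> 'k::{real_normed_field, euclidean_space}) set"
  assumes X: "koethe_space M X nX" and Y: "koethe_space M Y nY" and na: "non_atomic M"
    and fatou: "fatou_property M Y nY" and l: "l \<in> multipliers M X Y"
    and K: "compact_operator M X nX Y nY K"
    and c: "\<And>f. f \<in> X \<Longrightarrow> nX f \<le> 1 \<Longrightarrow> nY (\<lambda>x. mult_op l f x - K f x) \<le> c"
    and f: "f \<in> X" "nX f \<le> 1"
  shows "nY (mult_op l f) \<le> c"
proof (rule field_le_epsilon)
  interpret X: koethe_space M X nX by fact
  interpret Y: koethe_space M Y nY by fact
  have lY: "mult_op l f \<in> Y" if "f \<in> X" for f
    using l that by (auto simp: multipliers_def mult.commute mult_op_def)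
  have KY: "K f \<in> Y" if "f \<in> X" for f
    using K that by (auto simp: compact_operator_def linear_operator_def)
  have "0 \<le> nY (\<lambda>x. mult_op l f x - K f x)" using f by (intro Y.nrm_nonneg Y.diff_mem lY KY)
  with c[OF f] have "0 \<le> c" by simp
  fix e :: real assume "e > 0"
  show "nY (mult_op l f) \<le> c + e"
  proof (rule Y.norm_le_of_sign_flips[OF fatou na lY[OF f(1)]])
    show "0 \<le> c + e" using \<open>0 \<le> c\<close> \<open>e > 0\<close> by simp
    fix E :: "nat \<Rightarrow> 'a set" assume E [measurable]: "\<And>n. E n \<in> sets M"
    define F where "F n x = of_real (sign_flip (E n) x) * f x" for n x
    have [measurable]: "f \<in> borel_measurable M" using X.mem_measurable f by blast
    have [measurable]: "F n \<in> borel_measurable M" for n unfolding F_def by measurable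
    have "norm (F n x) \<le> norm (f x)" for n x by (simp add: F_def norm_mult sign_flip_def)
    then have F: "F n \<in> X" "nX (F n) \<le> 1" for n
      using X.nrm_mono[OF f(1), of "F n"] f(2) by auto
    obtain r where r: "strict_mono r \<and> (\<exists>y\<in>Y. (\<lambda>n. nY (\<lambda>x. K (F (r n)) x - y x)) \<longlonglongrightarrow> 0)"
      using compact_operator_subsequence[OF K F] ..
    then obtain y where y: "y \<in> Y" and lim: "(\<lambda>n. nY (\<lambda>x. K (F (r n)) x - y x)) \<longlonglongrightarrow> 0"
      by (auto elim: bexE)
    from r have r: "strict_mono r" ..
    have "eventually (\<lambda>n. nY (\<lambda>x. K (F (r n)) x - y x) < e) sequentially"
      by (rule order_tendstoD(2)[OF lim \<open>e > 0\<close>])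
    then obtain n0 where n0: "\<And>n. n \<ge> n0 \<Longrightarrow> nY (\<lambda>x. K (F (r n)) x - y x) < e"
      by (auto simp: eventually_sequentially)
    have "nY (\<lambda>x. of_real (sign_flip (E (r (n0 + k))) x) * mult_op l f x - y x) \<le> c + e" for k
    proof -
      have "(\<lambda>x. of_real (sign_flip (E (r (n0 + k))) x) * mult_op l f x - y x) =
          (\<lambda>x. (mult_op l (F (r (n0 + k))) x - K (F (r (n0 + k))) x) + (K (F (r (n0 + k))) x - y x))"
        by (simp add: F_def mult_op_def mult_ac)
      then have "nY (\<lambda>x. of_real (sign_flip (E (r (n0 + k))) x) * mult_op l f x - y x) \<le>
          nY (\<lambda>x. mult_op l (F (r (n0 + k))) x - K (F (r (n0 + k))) x) + nY (\<lambda>x. K (F (r (n0 + k))) x - y x)"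
        using Y.nrm_triangle[OF Y.diff_mem[OF lY KY] Y.diff_mem[OF KY y], OF F(1) F(1) F(1)]
        by (simp only:)
      also have "\<dots> \<le> c + e" using c[OF F] n0[of "n0 + k"] by (intro add_mono) (auto intro: less_imp_le)
      finally show ?thesis .
    qed
    moreover have "inj (\<lambda>k. r (n0 + k))" using strict_mono_eq[OF r] by (auto intro: injI)
    ultimately show "\<exists>s. inj s \<and> (\<exists>y\<in>Y. \<forall>k::nat. nY (\<lambda>x. of_real (sign_flip (E (s k)) x) * mult_op l f x - y x) \<le> c + e)"
      using y by (intro exI[where x = "\<lambda>k. r (n0 + k)"] conjI bexI[where x = y] allI)
  qed
qed

lemma operator_norm_upper:
  assumes "\<exists>C. \<forall>f\<in>X. nX f \<le> 1 \<longrightarrow> nY (T f) \<le> C" "f \<in> X" "nX f \<le> 1"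
  shows "nY (T f) \<le> operator_norm X nX nY T"
proof -
  have "bdd_above ((\<lambda>f. nY (T f)) ` {f \<in> X. nX f \<le> 1})" using assms(1) by (auto simp: bdd_above_def)
  then show ?thesis unfolding operator_norm_def using assms(2,3) by (intro cSUP_upper) auto
qed

lemma zero_compact_operator:
  fixes X Y :: "('a \<Rightarrow> 'k::{real_normed_field, euclidean_space}) set"
  assumes "koethe_space M X nX" and "koethe_space M Y nY"
  shows "compact_operator M X nX Y nY (\<lambda>f x. 0)"
proof -
  interpret X: koethe_space M X nX by fact
  interpret Y: koethe_space M Y nY by fact
  show ?thesis
    unfolding compact_operator_def linear_operator_def
    using Y.zero_mem Y.zero_nrm
    by (auto intro!: exI[of _ id] strict_mono_id bexI[of _ "\<lambda>x. 0"] simp: id_def strict_mono_def)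
qed

lemma essential_norm_mult_op:
  fixes X Y :: "('a \<Rightarrow> 'k::{real_normed_field, euclidean_space}) set"
  assumes X: "koethe_space M X nX" and Y: "koethe_space M Y nY" and na: "non_atomic M"
    and fatou: "fatou_property M Y nY" and l: "l \<in> multipliers M X Y"
  shows "essential_norm M X nX Y nY (mult_op l) = operator_norm X nX nY (mult_op l)"
proof -
  interpret X: koethe_space M X nX by fact
  interpret Y: koethe_space M Y nY by fact
  have lY: "mult_op l f \<in> Y" if "f \<in> X" for f
    using l that by (auto simp: multipliers_def mult.commute mult_op_def)
  have ball: "(\<lambda>x. 0) \<in> X" "nX (\<lambda>x. 0) \<le> 1" using X.zero_mem X.zero_nrm by auto
  have lower: "operator_norm X nX nY (mult_op l) \<le> operator_norm X nX nY (\<lambda>f x. mult_op l f x - K f x)"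
    if K: "compact_operator M X nX Y nY K" for K
  proof -
    have KY: "K f \<in> Y" if "f \<in> X" for f
      using K that by (auto simp: compact_operator_def linear_operator_def)
    obtain C D where C: "\<And>f. f \<in> X \<Longrightarrow> nX f \<le> 1 \<Longrightarrow> nY (mult_op l f) \<le> C"
      and D: "\<And>f. f \<in> X \<Longrightarrow> nX f \<le> 1 \<Longrightarrow> nY (K f) \<le> D"
      using multiplier_bounded[OF X Y l] compact_operator_bounded[OF Y K] unfolding mult_op_def by blast
    have "nY (\<lambda>x. mult_op l f x - K f x) \<le> C + D" if "f \<in> X" "nX f \<le> 1" for f
    proof -
      have "nY (\<lambda>x. mult_op l f x - K f x) \<le> nY (mult_op l f) + nY (\<lambda>x. 0 - K f x)"
        using Y.nrm_triangle[OF lY[OF that(1)] Y.diff_mem[OF Y.zero_mem KY[OF that(1)]]] by simp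
      also have "nY (\<lambda>x. 0 - K f x) = nY (K f)"
        using Y.nrm_minus_commute[OF Y.zero_mem KY[OF that(1)]] by simp
      finally show ?thesis using C[OF that] D[OF that] by simp
    qed
    then have "nY (\<lambda>x. mult_op l f x - K f x) \<le> operator_norm X nX nY (\<lambda>f x. mult_op l f x - K f x)"
      if "f \<in> X" "nX f \<le> 1" for f
      using that by (intro operator_norm_upper[where T = "\<lambda>f x. mult_op l f x - K f x"]) auto
    then have "nY (mult_op l f) \<le> operator_norm X nX nY (\<lambda>f x. mult_op l f x - K f x)"
      if "f \<in> X" "nX f \<le> 1" for f
      using that by (intro norm_mult_op_le_of_compact[OF X Y na fatou l K]) auto
    then show ?thesis
      unfolding operator_norm_def[of _ _ _ "mult_op l"] using ball by (intro cSUP_least) auto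
  qed
  let ?\<K> = "{K. compact_operator M X nX Y nY K}"
  have zero: "(\<lambda>f x. 0) \<in> ?\<K>" using zero_compact_operator[OF X Y] by simp
  show ?thesis
  proof (rule antisym)
    have "bdd_below ((\<lambda>K. operator_norm X nX nY (\<lambda>f x. mult_op l f x - K f x)) ` ?\<K>)"
      using lower by (auto intro!: bdd_belowI2)
    from cINF_lower[OF this zero]
    show "essential_norm M X nX Y nY (mult_op l) \<le> operator_norm X nX nY (mult_op l)"
      by (simp add: essential_norm_def)
    show "operator_norm X nX nY (mult_op l) \<le> essential_norm M X nX Y nY (mult_op l)"
      unfolding essential_norm_def using zero lower by (intro cINF_greatest) auto
  qed
qed

text \<open>
  The approximation of \<open>M\<^sub>l\<close> by \<open>K = M\<^sub>l\<close> has error \<open>0\<close>, so \<open>l\<close> annihilates the unit ball, and then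
  all of \<open>X\<close> by homogeneity.
\<close>

lemma compact_mult_op_eq_zero:
  fixes X Y :: "('a \<Rightarrow> 'k::{real_normed_field, euclidean_space}) set"
  assumes X: "koethe_space M X nX" and Y: "koethe_space M Y nY" and na: "non_atomic M"
    and fatou: "fatou_property M Y nY" and l: "l \<in> multipliers M X Y"
    and compact: "compact_operator M X nX Y nY (mult_op l)" and f: "f \<in> X"
  shows "AE x in M. mult_op l f x = 0"
proof -
  interpret X: koethe_space M X nX by fact
  interpret Y: koethe_space M Y nY by fact
  \<comment> \<open>The summand \<open>1\<close> in the denominator covers the case \<open>nX f = 0\<close>.\<close>
  define c :: 'k where "c = of_real (1 / (nX f + 1))"
  have c: "c \<noteq> 0" "norm c = 1 / (nX f + 1)"
    using X.nrm_nonneg[OF f] by (auto simp: c_def norm_divide norm_inverse simp del: of_real_divide of_real_inverse)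
  define g where "g x = c * f x" for x
  have "g \<in> X" "nX g \<le> 1"
    unfolding g_def using X.scale_mem[OF f] X.nrm_scale[OF f] X.nrm_nonneg[OF f] c by auto
  have lg: "mult_op l g \<in> Y"
    using l \<open>g \<in> X\<close> by (auto simp: multipliers_def mult.commute mult_op_def)
  have "nY (mult_op l g) \<le> 0"
    using \<open>g \<in> X\<close> \<open>nX g \<le> 1\<close> Y.zero_nrm
    by (intro norm_mult_op_le_of_compact[OF X Y na fatou l compact]) auto
  then have "AE x in M. mult_op l g x = 0"
    using Y.nrm_nonneg[OF lg] Y.nrm_eq_0_iff[OF lg] by simp
  then show ?thesis using c by (auto simp: mult_op_def g_def)
qed

theorem theorem4p1:
  fixes M :: "'a measure"
    and X Y :: "('a \<Rightarrow> 'k::{real_normed_field, euclidean_space}) set"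
    and nX nY :: "('a \<Rightarrow> 'k) \<Rightarrow> real"
  assumes "koethe_function_space M X nX" and "koethe_function_space M Y nY"
    and "fatou_property M X nX" and "fatou_property M Y nY"
    and "norm_separable X nX \<or> reflexive_space Y nY"
  shows "(\<forall>l\<in>multipliers M X Y.
        essential_norm M X nX Y nY (mult_op l) = multiplier_norm X nX nY l \<and>
        multiplier_norm X nX nY l = operator_norm X nX nY (mult_op l))
    \<and> \<not> (\<exists>l\<in>multipliers M X Y. compact_operator M X nX Y nY (mult_op l) \<and>
          \<not> (\<forall>f\<in>X. AE x in M. mult_op l f x = 0))"
proof -
  have X: "koethe_space M X nX" and Y: "koethe_space M Y nY" and na: "non_atomic M"
    using assms(1,2) by (auto simp: koethe_function_space_def koethe_function_space_axioms_def)
  have "multiplier_norm X nX nY l = operator_norm X nX nY (mult_op l)" for l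
    by (simp add: multiplier_norm_def operator_norm_def mult_op_def mult.commute)
  with essential_norm_mult_op[OF X Y na assms(4)] compact_mult_op_eq_zero[OF X Y na assms(4)]
  show ?thesis by (intro conjI ballI notI) (simp, simp, blast)
qed

end
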